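(* Let $A$ be a finite-dimensional anti-commutative algebra over a field $F$. Then the following are equivalent: (i) $A$ is a CB-algebra; (ii) every element of $A$ is an absolute zero divisor; (iii) $A$ is anti-associative.
   Context: An algebra over $F$ is a vector space with a bilinear product (not assumed associative), written by juxtaposition. It is anti-commutative if $x^2=0$ for all $x\in A$ (hence $xy=-yx$). An anti-commutative algebra $A$ is a CB-algebra if, whenever $x,y\in A$ satisfy $xy=0$, then $(xz)y=0$ for all $z\in A$. For $x\in A$ let $R_x:A\to A$, $a\mapsto ax$; the element $x$ is an absolute zero divisor if $R_x^2=0$. $A$ is anti-associative if $(xy)z=-x(yz)$ for all $x,y,z\in A$. *)

theory Defs
  imports Complex_Main
begin

text \<open>The carrier of an algebra is the whole type \<open>'a\<close>; its vector space structure over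
  the field \<open>'f\<close> is given by \<open>scale\<close>. The product is bilinear and not assumed associative,
  commutative or unital.\<close>

locale nonassoc_algebra = vector_space scale
  for scale :: "'f::field \<Rightarrow> 'a::ab_group_add \<Rightarrow> 'a" (infixr \<open>*s\<close> 75) +
  fixes mult :: "'a \<Rightarrow> 'a \<Rightarrow> 'a" (infixl \<open>\<cdot>\<close> 70)
  assumes linear_left: "Vector_Spaces.linear scale scale (\<lambda>x. x \<cdot> y)"
    and linear_right: "Vector_Spaces.linear scale scale (\<lambda>y. x \<cdot> y)"

locale anticommutative_algebra = nonassoc_algebra +
  assumes square_zero: "x \<cdot> x = 0"

locale CB_algebra = anticommutative_algebra +
  assumes CB: "x \<cdot> y = 0 \<Longrightarrow> (x \<cdot> z) \<cdot> y = 0"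

text \<open>The library locale \<open>finite_dimensional_vector_space\<close> carries a chosen basis as a
  parameter; here only the existence of a finite basis is required.\<close>

definition finite_dimensional :: "('f::field \<Rightarrow> 'a::ab_group_add \<Rightarrow> 'a) \<Rightarrow> bool"
  where "finite_dimensional scale \<longleftrightarrow> (\<exists>B. finite_dimensional_vector_space scale B)"

definition right_mult :: "('a \<Rightarrow> 'a \<Rightarrow> 'a) \<Rightarrow> 'a \<Rightarrow> 'a \<Rightarrow> 'a"
  where "right_mult mult x = (\<lambda>a. mult a x)"

definition absolute_zero_divisor :: "('a::zero \<Rightarrow> 'a \<Rightarrow> 'a) \<Rightarrow> 'a \<Rightarrow> bool"
  where "absolute_zero_divisor mult x \<longleftrightarrow> right_mult mult x \<circ> right_mult mult x = (\<lambda>_. 0)"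

definition anti_associative :: "('a::uminus \<Rightarrow> 'a \<Rightarrow> 'a) \<Rightarrow> bool"
  where "anti_associative mult \<longleftrightarrow>
    (\<forall>x y z. mult (mult x y) z = - mult x (mult y z))"

end

theory Submission
  imports Defs
begin

text \<open>Polarising \<open>(a x) x = 0\<close> and using anti-commutativity, the product \<open>(x y) z\<close> becomes
  invariant under cyclic permutations of its factors. This is anti-associativity, and it turns
  \<open>x y = 0\<close> into \<open>(x z) y = - ((x y) z) = 0\<close>. Conversely, the CB property applied to
  \<open>x x = 0\<close> gives \<open>(x z) x = 0\<close>.\<close>

lemma absolute_zero_divisor_iff:
  "absolute_zero_divisor mult x \<longleftrightarrow> (\<forall>a. mult (mult a x) x = 0)"
  by (auto simp: absolute_zero_divisor_def right_mult_def fun_eq_iff)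

context nonassoc_algebra
begin

lemma mult_add_left: "(x + y) \<cdot> z = x \<cdot> z + y \<cdot> z"
  using module_hom.add[OF linear_left[unfolded linear_iff_module_hom]] .

lemma mult_add_right: "x \<cdot> (y + z) = x \<cdot> y + x \<cdot> z"
  using module_hom.add[OF linear_right[unfolded linear_iff_module_hom]] .

lemma mult_minus_left: "(- x) \<cdot> y = - (x \<cdot> y)"
  using module_hom.neg[OF linear_left[unfolded linear_iff_module_hom]] .

lemma mult_zero_left: "0 \<cdot> y = 0"
  using module_hom.zero[OF linear_left[unfolded linear_iff_module_hom]] .

lemma mult_zero_right: "x \<cdot> 0 = 0"
  using module_hom.zero[OF linear_right[unfolded linear_iff_module_hom]] .

end

context anticommutative_algebra
begin

lemma anticommute: "x \<cdot> y = - (y \<cdot> x)"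
proof -
  have "x \<cdot> y + y \<cdot> x = 0"
    using square_zero[of "x + y", unfolded mult_add_left mult_add_right]
    by (simp add: square_zero add.commute)
  then show ?thesis
    by (simp add: eq_neg_iff_add_eq_0)
qed

text \<open>Linearisation of \<open>R_z^2 = 0\<close> at \<open>z = x + y\<close>: the two pure
  terms vanish, so the mixed terms cancel each other. No division by 2 occurs, hence any
  characteristic is allowed.\<close>

lemma absolute_zero_divisors_swap:
  assumes "\<forall>x. absolute_zero_divisor (\<cdot>) x"
  shows "(a \<cdot> x) \<cdot> y = - ((a \<cdot> y) \<cdot> x)"
proof -
  have sq: "(a \<cdot> z) \<cdot> z = 0" for z
    using assms by (simp add: absolute_zero_divisor_iff)
  have "(a \<cdot> x) \<cdot> y + (a \<cdot> y) \<cdot> x = 0"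
    using sq[of "x + y", unfolded mult_add_left mult_add_right]
    by (simp add: sq add.commute)
  then show ?thesis
    by (simp add: eq_neg_iff_add_eq_0)
qed

lemma absolute_zero_divisors_imp_anti_associative:
  assumes "\<forall>x. absolute_zero_divisor (\<cdot>) x"
  shows "anti_associative (\<cdot>)"
  unfolding anti_associative_def
proof (intro allI)
  fix x y z
  \<comment> \<open>The swap lemma keeps the leftmost factor and exchanges the other two, so
    \<open>y\<close> is first moved to the front.\<close>
  have "(x \<cdot> y) \<cdot> z = - ((y \<cdot> x) \<cdot> z)"
    by (metis anticommute mult_minus_left)
  also have "\<dots> = (y \<cdot> z) \<cdot> x"
    by (simp add: absolute_zero_divisors_swap[OF assms, of y x z])
  also have "\<dots> = - (x \<cdot> (y \<cdot> z))"
    by (rule anticommute)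
  finally show "(x \<cdot> y) \<cdot> z = - (x \<cdot> (y \<cdot> z))" .
qed

text \<open>Rebracketing creates a square: \<open>(a x) x = - a (x x) = 0\<close>.\<close>

lemma anti_associative_imp_absolute_zero_divisor:
  assumes "anti_associative (\<cdot>)"
  shows "absolute_zero_divisor (\<cdot>) x"
  using assms
  by (simp add: absolute_zero_divisor_iff anti_associative_def square_zero mult_zero_right)

lemma CB_algebra_iff_absolute_zero_divisors:
  "CB_algebra scale (\<cdot>) \<longleftrightarrow> (\<forall>x. absolute_zero_divisor (\<cdot>) x)"
proof
  assume "CB_algebra scale (\<cdot>)"
  then have "(x \<cdot> a) \<cdot> x = 0" for x a
    using CB_algebra.CB square_zero by blast
  \<comment> \<open>The CB property leaves \<open>x\<close> as the left inner factor; anti-commuting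
    it with \<open>a\<close> only changes the sign and gives the form required by
    \<open>R_x\<close>.\<close>
  then have "(a \<cdot> x) \<cdot> x = 0" for a x
    by (metis anticommute mult_minus_left neg_equal_0_iff_equal)
  then show "\<forall>x. absolute_zero_divisor (\<cdot>) x"
    by (simp add: absolute_zero_divisor_iff)
next
  assume azd: "\<forall>x. absolute_zero_divisor (\<cdot>) x"
  show "CB_algebra scale (\<cdot>)"
  \<comment> \<open>The ambient context supplies the other axioms, so only the CB implication
    remains. The swap turns its conclusion into \<open>- ((x y) z)\<close>, where the factor
    \<open>x y\<close> is zero.\<close>
  proof unfold_locales
    fix x y z
    assume "x \<cdot> y = 0"
    then show "(x \<cdot> z) \<cdot> y = 0"
      by (simp add: absolute_zero_divisors_swap[OF azd, of x z y] mult_zero_left)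
  qed
qed

end

theorem theorem3p7:
  fixes scale :: "'f::field \<Rightarrow> 'a::ab_group_add \<Rightarrow> 'a"
    and mult :: "'a \<Rightarrow> 'a \<Rightarrow> 'a"
  assumes "anticommutative_algebra scale mult"
    and "finite_dimensional scale"
  shows "(CB_algebra scale mult \<longleftrightarrow> (\<forall>x. absolute_zero_divisor mult x))
    \<and> ((\<forall>x. absolute_zero_divisor mult x) \<longleftrightarrow> anti_associative mult)"
proof -
  interpret anticommutative_algebra scale mult by fact
  show ?thesis
    using CB_algebra_iff_absolute_zero_divisors absolute_zero_divisors_imp_anti_associative
      anti_associative_imp_absolute_zero_divisor by blast
qed

end
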